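(* Let $f^- : (X,\Sigma_X,\mathbb{P}_X) \to (Y,\Sigma_Y,\mathbb{P}_Y)$ be an arrow in the category $\mathbf{Prob}$. (1) The function $f : Y \to X$ is $\Sigma_Y^*/\Sigma_X^*$-measurable. (2) $\mathbb{P}_Y^* \circ f^{-1} \ll \mathbb{P}_X^*$.
   Context: The category $\mathbf{Prob}$ has all probability spaces as objects; an arrow $f^- : (X,\Sigma_X,\mathbb{P}_X) \to (Y,\Sigma_Y,\mathbb{P}_Y)$ is a symbol corresponding uniquely to a measurable function $f : Y \to X$ (note the reversed direction) that is null-preserving, i.e. $\mathbb{P}_X(A)=0$ implies $\mathbb{P}_Y(f^{-1}(A))=0$ for $A \in \Sigma_X$. The completion $(X,\Sigma_X^*,\mathbb{P}_X^* )$ of a probability space $(X,\Sigma_X,\mathbb{P}_X)$ is given by $\Sigma_X^* := \{F \subset X \mid \exists A, B \in \Sigma_X,\ A \subset F \subset B \text{ and } \mathbb{P}_X(B - A) = 0\}$ and $\mathbb{P}_X^*(F) := \mathbb{P}_X(A) = \mathbb{P}_X(B)$ for any such $A, B$; it is again a probability space. For measures, $\mu \ll \nu$ means $\mu(A) = 0$ whenever $\nu(A) = 0$. *)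

theory Defs
  imports "HOL-Probability.Probability_Measure"
begin

(* An arrow X -> Y of Prob is a measurable, null-preserving function from the space of Y to the
   space of X: the direction is reversed. *)

definition null_preserving :: "'b measure \<Rightarrow> 'a measure \<Rightarrow> ('b \<Rightarrow> 'a) \<Rightarrow> bool" where
  "null_preserving Y X f \<longleftrightarrow>
     (\<forall>A\<in>sets X. emeasure X A = 0 \<longrightarrow> emeasure Y (f -` A \<inter> space Y) = 0)"

definition Prob_arrow :: "'a measure \<Rightarrow> 'b measure \<Rightarrow> ('b \<Rightarrow> 'a) \<Rightarrow> bool" where
  "Prob_arrow X Y f \<longleftrightarrow>
     prob_space X \<and> prob_space Y \<and> f \<in> Y \<rightarrow>\<^sub>M X \<and> null_preserving Y X f"

(* Note the argument order of the library's relation: absolutely_continuous M N means N << M. *)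

(* The completion of a probability space is the library's completion. The next two lemmas confirm
   that its measurable sets and its measure are given by sandwiching between measurable sets. *)

lemma sets_completion_sandwich:
  "sets (completion M) =
     {F. \<exists>A\<in>sets M. \<exists>B\<in>sets M. A \<subseteq> F \<and> F \<subseteq> B \<and> emeasure M (B - A) = 0}"
proof (intro set_eqI iffI)
  fix F assume "F \<in> sets (completion M)"
  then obtain S N N' where *: "F = S \<union> N" "N \<subseteq> N'" "N' \<in> null_sets M" "S \<in> sets M"
    by (rule sets_completionE)
  have "(S \<union> N') - S \<in> null_sets M"
    using * by (metis Un_Diff Diff_cancel Un_empty_left null_set_Diff)
  then show "F \<in> {F. \<exists>A\<in>sets M. \<exists>B\<in>sets M. A \<subseteq> F \<and> F \<subseteq> B \<and> emeasure M (B - A) = 0}"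
    using * by (intro CollectI bexI[of _ S] bexI[of _ "S \<union> N'"]) auto
next
  fix F assume "F \<in> {F. \<exists>A\<in>sets M. \<exists>B\<in>sets M. A \<subseteq> F \<and> F \<subseteq> B \<and> emeasure M (B - A) = 0}"
  then obtain A B where *: "A \<in> sets M" "B \<in> sets M" "A \<subseteq> F" "F \<subseteq> B" "emeasure M (B - A) = 0"
    by blast
  show "F \<in> sets (completion M)"
    by (rule sets_completionI[of F A "F - A" "B - A"]) (use * in auto)
qed

lemma emeasure_completion_sandwich:
  assumes "A \<in> sets M" "B \<in> sets M" "A \<subseteq> F" "F \<subseteq> B" "emeasure M (B - A) = 0"
  shows "emeasure (completion M) F = emeasure M A"
    and "emeasure (completion M) F = emeasure M B"
proof -
  have F: "F \<in> sets (completion M)"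
    unfolding sets_completion_sandwich using assms by blast
  have "emeasure M B = emeasure M (A \<union> (B - A))"
    using assms by (intro arg_cong[where f = "emeasure M"]) auto
  also have "\<dots> = emeasure M A"
    using assms by (intro emeasure_Un_null_set) auto
  finally have BA: "emeasure M B = emeasure M A" .
  have "emeasure (completion M) A \<le> emeasure (completion M) F"
    "emeasure (completion M) F \<le> emeasure (completion M) B"
    using assms F by (auto intro!: emeasure_mono simp del: emeasure_completion)
  then show "emeasure (completion M) F = emeasure M A" "emeasure (completion M) F = emeasure M B"
    using assms BA by simp_all
qed

end

theory Submission
  imports Defs
begin

text \<open>Pulling back along \<open>f\<close> respects a sandwich
  \<open>A \<subseteq> F \<subseteq> B\<close> in \<open>X\<close>: the preimages of
  \<open>A\<close> and \<open>B\<close> are measurable and their difference, the preimage of the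
  null set \<open>B - A\<close>, is null. This gives (1). For (2), a null set of the completion lies
  in a null set of \<open>X\<close>, whose preimage is null; this is
  \<open>vimage_null_sets_completion\<close>, which also supplies the null-set condition for
  (1).\<close>

lemma vimage_null_sets_completion:
  assumes f: "f \<in> Y \<rightarrow>\<^sub>M X" and np: "null_preserving Y X f"
    and N: "N \<in> null_sets (completion X)"
  shows "f -` N \<inter> space Y \<in> null_sets (completion Y)"
proof -
  obtain N' where N': "N' \<in> null_sets X" "N \<subseteq> N'"
    using N by (auto simp: null_sets_completion_iff2)
  then have "f -` N' \<inter> space Y \<in> null_sets Y"
    using f np by (auto simp: null_preserving_def null_sets_def)
  moreover have "f -` N \<inter> space Y \<subseteq> f -` N' \<inter> space Y"
    using N'(2) by auto
  ultimately show ?thesis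
    unfolding null_sets_completion_iff2 by blast
qed

lemma measurable_completion_completion:
  assumes f: "f \<in> Y \<rightarrow>\<^sub>M X" and np: "null_preserving Y X f"
  shows "f \<in> completion Y \<rightarrow>\<^sub>M completion X"
\<comment> \<open>As \<open>completion Y\<close> is complete, it suffices that \<open>f\<close> is
  measurable into \<open>X\<close> itself and pulls null sets of \<open>X\<close> back to null
  sets.\<close>
proof (rule completion.measurable_completion2)
  show f': "f \<in> completion Y \<rightarrow>\<^sub>M X"
    using f by (rule measurable_completion)
  show "null_sets X \<subseteq> null_sets (distr (completion Y) X f)"
    using vimage_null_sets_completion[OF f np null_sets_completionI] null_setsD2
    by (fastforce simp: null_sets_distr_iff[OF f'])
qed

theorem proposition6p2:
  fixes X :: "'a measure" and Y :: "'b measure" and f :: "'b \<Rightarrow> 'a"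
  assumes "Prob_arrow X Y f"
  shows "f \<in> completion Y \<rightarrow>\<^sub>M completion X \<and>
    absolutely_continuous (completion X) (distr (completion Y) (completion X) f)"
proof
  have f: "f \<in> Y \<rightarrow>\<^sub>M X" and np: "null_preserving Y X f"
    using assms by (auto simp: Prob_arrow_def)
  show f': "f \<in> completion Y \<rightarrow>\<^sub>M completion X"
    by (rule measurable_completion_completion[OF f np])
  show "absolutely_continuous (completion X) (distr (completion Y) (completion X) f)"
    unfolding absolutely_continuous_def
  proof
    fix N assume N: "N \<in> null_sets (completion X)"
    then show "N \<in> null_sets (distr (completion Y) (completion X) f)"
      \<comment> \<open>Part (1), as \<open>f'\<close>, lets null sets of the image measure be read
        off as preimages under \<open>f\<close>.\<close>
      using vimage_null_sets_completion[OF f np N] by (simp add: null_sets_distr_iff[OF f'] null_setsD2)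
  qed
qed

end
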